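(* Let $\alpha$ be a positive real number. Suppose $u:[0,1]\to\mathbb{R}$ is a measurable function such that $$u(1-x)+(1-x)^\alpha\, u\!\left(\frac{y}{1-x}\right) = u(y) + (1-y)^\alpha\, u\!\left(\frac{1-x-y}{1-y}\right)$$ for all $x,y\in[0,1)$ with $x+y\in[0,1]$. Then there exists $\lambda\in\mathbb{R}$ such that $u(x)=\lambda s_\alpha(x)$ for all $x\in[0,1]$, where $$s_1(x) = -x\log_2 x-(1-x)\log_2(1-x)$$ and, when $\alpha\neq 1$, $$s_\alpha(x)=\frac{1}{1-\alpha}\left(x^\alpha+(1-x)^\alpha-1\right).$$
   Context: Measurable means Lebesgue measurable. By convention $0\log_2 0:=\lim_{x\to 0}x\log_2 x=0$. Since $\alpha>0$, $0^\alpha=0$. *)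

theory Defs
  imports "HOL-Analysis.Analysis"
begin

(* At the endpoints x = 0 and x = 1, the convention 0 * log 2 0 = 0 holds since the product has a
   zero factor, and 0 powr \<alpha> = 0 by the library's definition of powr. *)
definition s_entropy :: "real \<Rightarrow> real \<Rightarrow> real" where
  "s_entropy \<alpha> x =
     (if \<alpha> = 1 then - x * log 2 x - (1 - x) * log 2 (1 - x)
      else 1 / (1 - \<alpha>) * (x powr \<alpha> + (1 - x) powr \<alpha> - 1))"

end

theory Submission
  imports Defs
begin

text \<open>The function \<open>g a b = (a + b) powr \<alpha> * u (a / (a + b))\<close> turns the functional equation into the
  2-cocycle equation on the semigroup of positive reals, with \<open>g\<close> homogeneous of degree \<open>\<alpha>\<close>.  The
  antisymmetrization of \<open>g\<close> is biadditive, hence zero by measurability.  For \<open>\<alpha> \<noteq> 1\<close>, computing the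
  entropy of the product of \<open>(x, 1 - x)\<close> and \<open>(1/2, 1/2)\<close> in two ways determines \<open>u\<close>.  For \<open>\<alpha> = 1\<close>,
  measurability makes \<open>g 1\<close> locally bounded, so averaging the cocycle equation over one variable
  writes \<open>g\<close> as the coboundary of a locally bounded \<open>\<phi>\<close>.  By homogeneity \<open>\<phi> (t * a) - t * \<phi> a\<close> is
  additive in \<open>a\<close>, hence linear, so \<open>\<phi> t / t - \<phi> 1\<close> turns products into sums and is a multiple of
  the logarithm.\<close>

section \<open>Bounded additive functions on the positive reals\<close>

text \<open>Subtracting the linear function through \<open>k 1\<close> leaves an additive
  \<open>d\<close> that vanishes at the positive integers. Removing integer parts bounds
  \<open>d\<close> on all positive reals, and a nonzero value would have unboundedly large
  multiples.\<close>

lemma additive_bounded_imp_linear: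
  fixes k :: "real \<Rightarrow> real"
  assumes add: "\<And>a b. a > 0 \<Longrightarrow> b > 0 \<Longrightarrow> k (a + b) = k a + k b"
    and bdd: "\<And>a. 0 < a \<Longrightarrow> a < 1 \<Longrightarrow> \<bar>k a\<bar> \<le> M"
    and "x > 0"
  shows "k x = k 1 * x"
proof -
  define d where "d x = k x - k 1 * x" for x
  have d_add: "d (a + b) = d a + d b" if "a > 0" "b > 0" for a b
    using add[OF that] by (simp add: d_def algebra_simps)
  have d_mult: "d (real (Suc n) * a) = real (Suc n) * d a" if "a > 0" for n a
  proof (induction n)
    case (Suc n)
    have "d (real (Suc (Suc n)) * a) = d (real (Suc n) * a + a)"
      by (simp add: algebra_simps)
    also have "\<dots> = d (real (Suc n) * a) + d a"
      using that by (intro d_add) auto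
    finally show ?case
      using Suc by (simp add: algebra_simps)
  qed simp
  have d_1: "d 1 = 0"
    by (simp add: d_def)
  have d_nat: "d (real (Suc n)) = 0" for n
    using d_mult[of 1 n] d_1 by simp
  have d_bdd: "\<bar>d a\<bar> \<le> M + \<bar>k 1\<bar>" if "0 < a" "a < 1" for a
  proof -
    have "\<bar>k 1 * a\<bar> \<le> \<bar>k 1\<bar>"
      using that by (simp add: abs_mult mult_left_le)
    thus ?thesis
      using bdd[OF that] unfolding d_def by linarith
  qed
  \<comment> \<open>Additivity is available for positive arguments only, so integers (fractional
    part 0) and arguments below 1 (integer part 0) are treated separately.\<close>
  have d_bdd': "\<bar>d a\<bar> \<le> M + \<bar>k 1\<bar>" if "0 < a" for a
  proof (cases "a \<in> \<int>")
    case True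
    then obtain i where i: "a = of_int i"
      by (elim Ints_cases)
    with that have "a = real (Suc (nat (i - 1)))"
      by simp
    \<comment> \<open>The value at \<open>1/2\<close> only serves to show that the bound is
      nonnegative.\<close>
    with d_nat d_bdd[of "1/2"] show ?thesis by simp
  next
    case False
    have f: "0 < frac a" "frac a < 1"
      using False by (simp_all add: frac_lt_1)
    show ?thesis
    proof (cases "a < 1")
      case False
      then obtain n where n: "nat \<lfloor>a\<rfloor> = Suc n"
        by (cases "nat \<lfloor>a\<rfloor>") auto
      hence "a = real (Suc n) + frac a"
        using that by (simp add: frac_def flip: n)
      hence "d a = d (real (Suc n)) + d (frac a)"
        using d_add[of "real (Suc n)" "frac a"] f by simp
      thus ?thesis
        using d_nat d_bdd[OF f] by simp
    qed (use d_bdd that in auto)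
  qed
  have "d x = 0"
  proof (rule ccontr)
    assume "d x \<noteq> 0"
    then obtain n where n: "real n * \<bar>d x\<bar> > M + \<bar>k 1\<bar>"
      using reals_Archimedean3[of "\<bar>d x\<bar>"] by auto
    have "\<bar>d (real (Suc n) * x)\<bar> = real (Suc n) * \<bar>d x\<bar>"
      using d_mult[OF \<open>x > 0\<close>] by (simp add: abs_mult del: of_nat_Suc)
    moreover have "real (Suc n) * \<bar>d x\<bar> \<ge> real n * \<bar>d x\<bar>"
      by (intro mult_right_mono) auto
    moreover have "\<bar>d (real (Suc n) * x)\<bar> \<le> M + \<bar>k 1\<bar>"
      using \<open>x > 0\<close> by (intro d_bdd') auto
    ultimately show False
      using n by linarith
  qed
  thus ?thesis
    by (simp add: d_def)
qed

section \<open>Lebesgue measurability and common points of boundedness\<close>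

text \<open>Composing a Lebesgue measurable function with a continuous map can destroy
  measurability. Here preimages under the composite are \<open>p\<close>-images of preimages under
  \<open>f\<close>, and a differentiable \<open>p\<close> maps Lebesgue measurable sets to Lebesgue
  measurable sets.\<close>

lemma borel_measurable_lebesgue_on_compose_inverse:
  fixes f :: "real \<Rightarrow> real" and h :: "real \<Rightarrow> real" and p :: "real \<Rightarrow> real"
  assumes f: "f \<in> borel_measurable (lebesgue_on S)" and S: "S \<in> sets lebesgue"
    and p: "p differentiable_on S" and T: "p ` S = T"
    and inv: "\<And>x. x \<in> S \<Longrightarrow> h (p x) = x"
  shows "(\<lambda>x. f (h x)) \<in> borel_measurable (lebesgue_on T)"
proof (rule measurableI)
  fix A :: "real set" assume A: "A \<in> sets borel"
  have "(\<lambda>x. f (h x)) -` A \<inter> space (lebesgue_on T) = p ` (f -` A \<inter> space (lebesgue_on S))"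
    using inv T[symmetric] by (auto simp: space_restrict_space)
  also have "\<dots> \<in> sets (lebesgue_on T)"
    using differentiable_image_in_sets_lebesgue_on[OF S measurable_sets[OF f A] _ p] T by simp
  finally show "(\<lambda>x. f (h x)) -` A \<inter> space (lebesgue_on T) \<in> sets (lebesgue_on T)" .
qed auto

text \<open>As \<open>n\<close> grows, these sets of finite measure decrease to the empty set
  because \<open>v\<close> is real-valued; continuity from above gives the claim.\<close>

lemma measure_large_values_small:
  fixes v :: "real \<Rightarrow> real"
  assumes v: "v \<in> borel_measurable (lebesgue_on {0<..})" and "e > 0"
  obtains n :: nat where "{w \<in> {0<..<R}. \<bar>v w\<bar> > real n} \<in> lmeasurable"
    "measure lebesgue {w \<in> {0<..<R}. \<bar>v w\<bar> > real n} < e"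
proof -
  define B where "B n = {w \<in> {0<..<R}. \<bar>v w\<bar> > real n}" for n :: nat
  have v': "v \<in> borel_measurable (lebesgue_on {0<..<R})"
    by (rule measurable_restrict_mono[OF v]) auto
  have B: "B n \<in> sets lebesgue" for n
  proof -
    have "{w \<in> space (lebesgue_on {0<..<R}). \<bar>v w\<bar> > real n} \<in> sets (lebesgue_on {0<..<R})"
      using v' by measurable
    thus ?thesis
      by (simp add: B_def space_restrict_space sets_restrict_space_iff)
  qed
  have Bl: "B n \<in> lmeasurable" for n
    by (rule fmeasurableI2[of "{0<..<R}"]) (use B in \<open>auto simp: B_def\<close>)
  have "(\<lambda>n. measure lebesgue (B n)) \<longlonglongrightarrow> measure lebesgue (\<Inter>n. B n)"
  proof (rule Lim_measure_decseq)
    show "range B \<subseteq> sets lebesgue"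
      using B by blast
    show "decseq B"
      unfolding decseq_def
    proof (intro allI impI subsetI)
      fix i j :: nat and w assume "i \<le> j" "w \<in> B j"
      moreover from \<open>i \<le> j\<close> have "real i \<le> real j" by simp
      ultimately show "w \<in> B i" unfolding B_def by (blast intro: le_less_trans)
    qed
    show "emeasure lebesgue (B i) \<noteq> \<infinity>" for i
      using fmeasurableD2[OF Bl[of i]] by simp
  qed
  also have "(\<Inter>n. B n) = {}"
  proof -
    have "\<exists>n. w \<notin> B n" for w
    proof -
      obtain n where "\<bar>v w\<bar> < real n"
        using reals_Archimedean2 by blast
      hence "w \<notin> B n"
        by (simp add: B_def)
      thus ?thesis ..
    qed
    thus ?thesis by blast
  qed
  finally have "eventually (\<lambda>n. measure lebesgue (B n) < e) sequentially"
    using \<open>e > 0\<close> by (intro order_tendstoD) auto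
  then obtain n where "measure lebesgue (B n) < e"
    by (auto simp: eventually_sequentially)
  with Bl[of n] show ?thesis
    using that[of n] by (simp add: B_def)
qed

text \<open>The bound \<open>N\<close> is uniform over all \<open>P\<close>. Each pair excludes a
  set of parameters \<open>c\<close> that is an affine image of one small set; at most
  \<open>m\<close> such images are too small to cover \<open>{1..2}\<close>.\<close>

lemma common_point_of_boundedness:
  fixes v :: "real \<Rightarrow> real" and m :: nat
  assumes v: "v \<in> borel_measurable (lebesgue_on {0<..})" and M: "M > 0"
  obtains N where "\<And>P. finite P \<Longrightarrow> card P \<le> m \<Longrightarrow>
      (\<And>d r. (d, r) \<in> P \<Longrightarrow> d \<ge> 0 \<and> 0 < r \<and> r \<le> M \<and> (2 + d) / r < R) \<Longrightarrow>
      \<exists>c\<in>{1..2}. \<forall>(d, r)\<in>P. \<bar>v ((c + d) / r)\<bar> \<le> N"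
proof -
  \<comment> \<open>Each excluded set has measure at most \<open>M * e = 1 / (m + 1)\<close>, so
    \<open>m\<close> of them have total measure below 1.\<close>
  define e where "e = 1 / (real (Suc m) * M)"
  have "e > 0"
    using M by (simp add: e_def)
  then obtain n :: nat where B: "{w \<in> {0<..<R}. \<bar>v w\<bar> > real n} \<in> lmeasurable"
    and Be: "measure lebesgue {w \<in> {0<..<R}. \<bar>v w\<bar> > real n} < e"
    using measure_large_values_small[OF v] by blast
  define B where "B = {w \<in> {0<..<R}. \<bar>v w\<bar> > real n}"
  have "\<exists>c\<in>{1..2}. \<forall>(d, r)\<in>P. \<bar>v ((c + d) / r)\<bar> \<le> real n"
    if P: "finite P" "card P \<le> m"
      and bds: "\<And>d r. (d, r) \<in> P \<Longrightarrow> d \<ge> 0 \<and> 0 < r \<and> r \<le> M \<and> (2 + d) / r < R" for P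
  proof (rule ccontr)
    assume contra: "\<not> ?thesis"
    \<comment> \<open>Solving \<open>w = (c + d) / r\<close> for \<open>c\<close>:
      \<open>T (d, r)\<close> contains every \<open>c\<close> in \<open>{1..2}\<close> that is bad
      for this pair.\<close>
    define T where "T = (\<lambda>(d, r). (\<lambda>w. r *\<^sub>R w + (- d)) ` B)"
    have meas: "T x \<in> lmeasurable" and le: "measure lebesgue (T x) \<le> M * e" if "x \<in> P" for x
    proof -
      obtain d r where x: "x = (d, r)" by force
      note b = bds[OF that[unfolded x]]
      have "emeasure lebesgue (T x) = ennreal \<bar>r\<bar> * emeasure lebesgue B"
        using emeasure_lebesgue_affine[of r "-d" B] by (simp add: T_def x)
      moreover have "T x \<in> sets lebesgue"
        using B unfolding T_def x B_def
        by (auto intro!: differentiable_image_in_sets_lebesgue derivative_intros)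
      moreover have "emeasure lebesgue B < \<infinity>"
        using B unfolding B_def fmeasurable_def by blast
      hence "ennreal \<bar>r\<bar> * emeasure lebesgue B < \<infinity>"
        using ennreal_mult_less_top by auto
      ultimately show "T x \<in> lmeasurable"
        by (intro fmeasurableI) auto
      have "measure lebesgue (T x) = r * measure lebesgue B"
        using measure_lebesgue_affine[of r "-d" B] b by (simp add: T_def x)
      also have "\<dots> \<le> M * e"
        using b Be M by (intro mult_mono) (auto simp: B_def)
      finally show "measure lebesgue (T x) \<le> M * e" .
    qed
    have "{1..2} \<subseteq> (\<Union>x\<in>P. T x)"
    proof
      fix c :: real assume c: "c \<in> {1..2}"
      with contra have "\<not> (\<forall>(d, r)\<in>P. \<bar>v ((c + d) / r)\<bar> \<le> real n)"
        by blast
      then obtain d r where dr: "(d, r) \<in> P" "\<bar>v ((c + d) / r)\<bar> > real n"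
        by (auto simp: not_le)
      note b = bds[OF dr(1)]
      have "(c + d) / r \<le> (2 + d) / r"
        using b c by (intro divide_right_mono) auto
      hence "(c + d) / r \<in> B"
        using b c dr by (auto simp: B_def)
      moreover have "c = r *\<^sub>R ((c + d) / r) + (- d)"
        using b by simp
      ultimately have "c \<in> T (d, r)"
        unfolding T_def prod.case by (rule image_eqI[rotated])
      with dr show "c \<in> (\<Union>x\<in>P. T x)" by blast
    qed
    hence "measure lebesgue {1..2::real} \<le> measure lebesgue (\<Union>x\<in>P. T x)"
      using P meas by (intro measure_mono_fmeasurable fmeasurable.finite_UN) auto
    also have "\<dots> \<le> (\<Sum>x\<in>P. measure lebesgue (T x))"
      using P meas by (intro measure_UNION_le) (auto simp: fmeasurable_def)
    also have "\<dots> \<le> (\<Sum>x\<in>P. M * e)"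
      using le by (intro sum_mono)
    also have "\<dots> = real (card P) * (M * e)"
      by simp
    also have "\<dots> \<le> real m * (M * e)"
      using P M \<open>e > 0\<close> by (intro mult_right_mono) auto
    also have "\<dots> = real m / real (Suc m)"
      using M by (simp add: e_def del: of_nat_Suc)
    also have "\<dots> < 1"
      by simp
    finally show False by simp
  qed
  with that show ?thesis .
qed

text \<open>Writing \<open>k a = k (c + a) - k c\<close> with a \<open>c\<close> at which both terms
  are bounded by \<open>N\<close> reduces the claim to bounded additive functions.\<close>

lemma additive_measurable_imp_linear:
  fixes k :: "real \<Rightarrow> real"
  assumes add: "\<And>a b. a > 0 \<Longrightarrow> b > 0 \<Longrightarrow> k (a + b) = k a + k b"
    and meas: "k \<in> borel_measurable (lebesgue_on {0<..})"
    and "x > 0"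
  shows "k x = k 1 * x"
proof -
  obtain N where N: "\<And>P. finite P \<Longrightarrow> card P \<le> 2 \<Longrightarrow>
      (\<And>d r. (d, r) \<in> P \<Longrightarrow> d \<ge> 0 \<and> 0 < r \<and> r \<le> 1 \<and> (2 + d) / r < 4) \<Longrightarrow>
      \<exists>c\<in>{1..2}. \<forall>(d, r)\<in>P. \<bar>k ((c + d) / r)\<bar> \<le> N"
    by (rule common_point_of_boundedness[OF meas zero_less_one, of 2 4]) auto
  have "\<bar>k a\<bar> \<le> 2 * N" if "0 < a" "a < 1" for a
  proof -
    have "\<exists>c\<in>{1..2}. \<forall>(d, r)\<in>{(0, 1), (a, 1)}. \<bar>k ((c + d) / r)\<bar> \<le> N"
      using that by (intro N) (auto simp: card_insert_if)
    then obtain c where "c \<in> {1..2}" "\<bar>k c\<bar> \<le> N" "\<bar>k (c + a)\<bar> \<le> N"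
      by auto
    with add[of c a] that show ?thesis by auto
  qed
  from additive_bounded_imp_linear[OF add this \<open>x > 0\<close>] show ?thesis .
qed


section \<open>Homogeneous cocycles\<close>

text \<open>Homogeneity recovers \<open>g\<close> from either section through 1, so measurability is
  asked of these functions of one variable.\<close>

locale homogeneous_cocycle =
  fixes g :: "real \<Rightarrow> real \<Rightarrow> real" and \<alpha> :: real
  assumes cocycle: "a > 0 \<Longrightarrow> b > 0 \<Longrightarrow> c > 0 \<Longrightarrow> g (a + b) c + g a b = g a (b + c) + g b c"
    and homogeneous: "t > 0 \<Longrightarrow> a > 0 \<Longrightarrow> b > 0 \<Longrightarrow> g (t * a) (t * b) = t powr \<alpha> * g a b"
    and measurable_left: "(\<lambda>z. g z 1) \<in> borel_measurable (lebesgue_on {0<..})"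
    and measurable_right: "g 1 \<in> borel_measurable (lebesgue_on {0<..})"
begin

text \<open>The antisymmetrization of a cocycle is biadditive.  Without measurability it need not
  vanish: for \<open>\<alpha> = 2\<close> and a derivation \<open>d\<close> of the reals, \<open>g a b = a * d b - b * d a\<close> is a
  counterexample.\<close>

lemma symmetric:
  assumes "a > 0" "b > 0"
  shows "g a b = g b a"
proof -
  define k where "k z = g z 1 - g 1 z" for z
  \<comment> \<open>Subtracting the second equation from the first cancels \<open>g x y\<close>; the
    third eliminates \<open>g x (1 + y)\<close> and \<open>g (1 + x) y\<close>.\<close>
  have "k (x + y) = k x + k y" if "x > 0" "y > 0" for x y
    using cocycle[of x y 1] cocycle[of 1 x y] cocycle[of x 1 y] that
    by (simp add: k_def add.commute)
  moreover have "k \<in> borel_measurable (lebesgue_on {0<..})"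
    unfolding k_def using measurable_left measurable_right by measurable
  \<comment> \<open>The slope \<open>k 1\<close> is zero by the definition of
    \<open>k\<close>.\<close>
  ultimately have "k (a / b) = k 1 * (a / b)"
    using assms by (intro additive_measurable_imp_linear) auto
  hence "g (a / b) 1 = g 1 (a / b)"
    by (simp add: k_def)
  thus ?thesis
    using homogeneous[of b "a / b" 1] homogeneous[of b 1 "a / b"] assms by simp
qed

text \<open>By the cocycle equation the left side is
  \<open>g a b + g (a + b) c + g (a + b + c) d\<close>, the cost of adding the four terms one after
  another. This is unchanged when \<open>b\<close> and \<open>c\<close> are swapped.\<close>

lemma four_term_symmetry:
  assumes "a > 0" "b > 0" "c > 0" "d > 0"
  shows "g a b + g c d + g (a + b) (c + d) = g a c + g b d + g (a + c) (b + d)"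
proof -
  have "g (a + b + c) d + g (a + b) c = g (a + b) (c + d) + g c d"
    using assms by (intro cocycle) auto
  moreover have "g (a + c + b) d + g (a + c) b = g (a + c) (b + d) + g b d"
    using assms by (intro cocycle) auto
  moreover have "a + c + b = a + b + c"
    by simp
  moreover have "g (a + c) b + g a c = g (a + b) c + g a b"
    using cocycle[of a b c] cocycle[of a c b] symmetric[of b c] assms by (metis add.commute)
  ultimately show ?thesis
    by simp
qed

text \<open>A product distribution can be grouped in two ways.\<close>

lemma product_rule:
  assumes "0 < x" "x < 1" "0 < y" "y < 1"
  shows "(x powr \<alpha> + (1 - x) powr \<alpha> - 1) * g y (1 - y) = (y powr \<alpha> + (1 - y) powr \<alpha> - 1) * g x (1 - x)"
proof -
  have "g (x * y) (x * (1 - y)) + g ((1 - x) * y) ((1 - x) * (1 - y))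
      + g (x * y + x * (1 - y)) ((1 - x) * y + (1 - x) * (1 - y))
      = g (x * y) ((1 - x) * y) + g (x * (1 - y)) ((1 - x) * (1 - y))
      + g (x * y + (1 - x) * y) (x * (1 - y) + (1 - x) * (1 - y))"
    using assms by (intro four_term_symmetry) auto
  moreover have "x * y + x * (1 - y) = x" "(1 - x) * y + (1 - x) * (1 - y) = 1 - x"
    "x * y + (1 - x) * y = y" "x * (1 - y) + (1 - x) * (1 - y) = 1 - y"
    by (simp_all add: algebra_simps)
  moreover have "g (x * y) ((1 - x) * y) = y powr \<alpha> * g x (1 - x)"
    "g (x * (1 - y)) ((1 - x) * (1 - y)) = (1 - y) powr \<alpha> * g x (1 - x)"
    using homogeneous[of y x "1 - x"] homogeneous[of "1 - y" x "1 - x"] assms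
    by (simp_all add: mult.commute)
  moreover have "g (x * y) (x * (1 - y)) = x powr \<alpha> * g y (1 - y)"
    "g ((1 - x) * y) ((1 - x) * (1 - y)) = (1 - x) powr \<alpha> * g y (1 - y)"
    using homogeneous[of x y "1 - y"] homogeneous[of "1 - x" y "1 - y"] assms by simp_all
  ultimately have "x powr \<alpha> * g y (1 - y) + (1 - x) powr \<alpha> * g y (1 - y) + g x (1 - x)
      = y powr \<alpha> * g x (1 - x) + (1 - y) powr \<alpha> * g x (1 - x) + g y (1 - y)"
    by (simp only:)
  thus ?thesis
    by (simp add: algebra_simps)
qed

end

section \<open>Degree one: the cocycle as a coboundary\<close>

locale homogeneous_cocycle_1 = homogeneous_cocycle g 1 for g
begin

lemma homogeneous_1: "t > 0 \<Longrightarrow> a > 0 \<Longrightarrow> b > 0 \<Longrightarrow> g (t * a) (t * b) = t * g a b"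
  using homogeneous[of t a b] by simp

lemma eq_scaled: "a > 0 \<Longrightarrow> b > 0 \<Longrightarrow> g a b = a * g 1 (b / a)"
  using homogeneous_1[of a 1 "b / a"] by simp

text \<open>In \<open>g 1 z = g 1 (z + c) + g z c - g (1 + z) c\<close> the parameter \<open>c\<close> is free; all three terms on the
  right are scaled values of \<open>g 1\<close> at points affine in \<open>c\<close>.\<close>

lemma bounded_right:
  assumes "p > 0"
  obtains M where "\<And>z. p \<le> z \<Longrightarrow> z \<le> q \<Longrightarrow> \<bar>g 1 z\<bar> \<le> M"
proof (cases "p \<le> q")
  case True
  define R where "R = 3 + q + 2 / p"
  obtain N where N: "\<And>P. finite P \<Longrightarrow> card P \<le> 3 \<Longrightarrow>
      (\<And>d r. (d, r) \<in> P \<Longrightarrow> d \<ge> 0 \<and> 0 < r \<and> r \<le> 1 + q \<and> (2 + d) / r < R) \<Longrightarrow>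
      \<exists>c\<in>{1..2}. \<forall>(d, r)\<in>P. \<bar>g 1 ((c + d) / r)\<bar> \<le> N"
    by (rule common_point_of_boundedness[OF measurable_right, of "1 + q" 3 R]) (use assms True in auto)
  have "\<bar>g 1 z\<bar> \<le> 2 * (1 + q) * N" if z: "p \<le> z" "z \<le> q" for z
  proof -
    have "2 / z \<le> 2 / p" "2 / (1 + z) \<le> 2 / p" "2 / p > 0"
      using z assms by (auto simp: frac_le)
    hence "2 + z < R" "2 / z < R" "2 / (1 + z) < R"
      using assms z unfolding R_def by linarith+
    \<comment> \<open>The three pairs encode the points \<open>c + z\<close>, \<open>c / z\<close>
      and \<open>c / (1 + z)\<close>.\<close>
    hence "\<exists>c\<in>{1..2}. \<forall>(d, r)\<in>{(z, 1), (0, z), (0, 1 + z)}. \<bar>g 1 ((c + d) / r)\<bar> \<le> N"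
      using assms z by (intro N) (auto simp: card_insert_if)
    then obtain c where c: "c \<in> {1..2}" "\<bar>g 1 (c + z)\<bar> \<le> N" "\<bar>g 1 (c / z)\<bar> \<le> N"
      "\<bar>g 1 (c / (1 + z))\<bar> \<le> N"
      by auto
    have "g 1 z = g 1 (z + c) + z * g 1 (c / z) - (1 + z) * g 1 (c / (1 + z))"
      using cocycle[of 1 z c] eq_scaled[of z c] eq_scaled[of "1 + z" c] c(1) z(1) assms by auto
    also have "\<bar>\<dots>\<bar> \<le> \<bar>g 1 (z + c)\<bar> + \<bar>z * g 1 (c / z)\<bar> + \<bar>(1 + z) * g 1 (c / (1 + z))\<bar>"
      by linarith
    also have "\<dots> \<le> N + z * N + (1 + z) * N"
      using c z assms by (intro add_mono) (auto simp: abs_mult add.commute mult_left_mono)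
    also have "\<dots> = 2 * (1 + z) * N"
      by (simp add: algebra_simps)
    also have "\<dots> \<le> 2 * (1 + q) * N"
      using c z by (intro mult_right_mono) auto
    finally show ?thesis .
  qed
  with that show ?thesis .
next
  case False
  with that[of 0] show ?thesis by force
qed

lemma integrable_right:
  assumes "p > 0"
  shows "g 1 integrable_on {p..q}"
proof -
  obtain M where M: "\<And>z. p \<le> z \<Longrightarrow> z \<le> q \<Longrightarrow> \<bar>g 1 z\<bar> \<le> M"
    by (rule bounded_right[OF assms, of q]) auto
  show ?thesis
  proof (rule measurable_bounded_by_integrable_imp_integrable)
    show "g 1 \<in> borel_measurable (lebesgue_on {p..q})"
      by (rule measurable_restrict_mono[OF measurable_right]) (use assms in auto)
  qed (use M in auto)
qed

lemma integrable_section: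
  assumes "a > 0" "p > 0"
  shows "g a integrable_on {p..q}"
proof (cases "p \<le> q")
  case True
  have "(\<lambda>c. a * g 1 (c / a)) integrable_on {p..q}"
    using integrable_on_affinity[of "1 / a" "g 1" "p / a" "q / a" 0]
      integrable_right[of "p / a" "q / a"] assms True by (intro integrable_on_mult_right) auto
  moreover have "a * g 1 (c / a) = g a c" if "c \<in> {p..q}" for c
    using eq_scaled[of a c] that assms by auto
  ultimately show ?thesis
    by (rule integrable_eq) auto
qed auto

text \<open>The first integral alone would work if averaging over \<open>{1..2}\<close> were
  invariant under shifts. The error from a shift is itself a coboundary, and the second integral
  cancels it.\<close>

definition potential :: "real \<Rightarrow> real" where
  "potential a = integral {1..2} (g a) - integral {1..a + 1} (g 1)"

text \<open>Integrate the cocycle equation for \<open>(a, b, c)\<close> over \<open>c \<in> {1..2}\<close>.  The integral of \<open>g a\<close> over the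
  shifted interval \<open>{1 + b..2 + b}\<close> is brought back to \<open>{1..2}\<close> by the equation for \<open>(a, c, 1)\<close>.\<close>

lemma coboundary:
  assumes "a > 0" "b > 0"
  shows "g a b = potential a + potential b - potential (a + b)"
proof -
  note int = integrable_section
  have shift: "integral {p..q} (\<lambda>c. f (d + c)) = integral {p + d..q + d} f" for p q d and f :: "real \<Rightarrow> real"
    using integral_shift_Icc_real[of p q f d] by (simp add: o_def)
  have int_shift: "(\<lambda>c. g x (d + c)) integrable_on {p..q}" if "x > 0" "p + d > 0" for p q d x
    using integrable_on_shift_Icc_real[of "g x" d p q] int[OF that] by (simp add: o_def)
  have "g a b = integral {1..2::real} (\<lambda>c. g a b)"
    by simp
  also have "\<dots> = integral {1..2} (\<lambda>c. g a (b + c) + g b c - g (a + b) c)"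
    using cocycle[of a b] assms by (intro integral_cong) (auto simp: algebra_simps)
  also have "\<dots> = integral {1 + b..2 + b} (g a) + integral {1..2} (g b) - integral {1..2} (g (a + b))"
    using assms by (simp add: integral_diff integral_add integrable_add int int_shift shift)
  also have "integral {1 + b..2 + b} (g a) =
      integral {1..2} (g a) + (integral {2..2 + b} (g a) - integral {1..1 + b} (g a))"
    using assms Henstock_Kurzweil_Integration.integral_combine[of 1 "1 + b" "2 + b" "g a"] Henstock_Kurzweil_Integration.integral_combine[of 1 2 "2 + b" "g a"]
    by (auto simp: int)
  also have "integral {2..2 + b} (g a) - integral {1..1 + b} (g a)
      = integral {1..1 + b} (\<lambda>c. g a (1 + c) - g a c)"
    using assms shift[of 1 "1 + b" "g a" 1] int_shift[of a 1 1 "1 + b"]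
    by (simp add: integral_diff int add.commute)
  \<comment> \<open>Symmetry is what moves the argument 1 into the first slot, so that the increment
    no longer depends on \<open>a\<close> except through a shift.\<close>
  also have "\<dots> = integral {1..1 + b} (\<lambda>c. g 1 (a + c) - g 1 c)"
  proof (intro integral_cong)
    fix c assume "c \<in> {1..1 + b}"
    thus "g a (1 + c) - g a c = g 1 (a + c) - g 1 c"
      using cocycle[of a c 1] symmetric[of c 1] symmetric[of "a + c" 1] assms
      by (simp add: add.commute)
  qed
  also have "\<dots> = integral {1 + a..1 + b + a} (g 1) - integral {1..1 + b} (g 1)"
    using assms by (simp add: integral_diff int int_shift shift)
  also have "integral {1 + a..1 + b + a} (g 1) = integral {1..a + b + 1} (g 1) - integral {1..a + 1} (g 1)"
    using assms Henstock_Kurzweil_Integration.integral_combine[of 1 "1 + a" "1 + b + a" "g 1"] by (simp add: int add_ac)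
  finally show ?thesis
    by (simp add: potential_def add_ac)
qed

section \<open>Degree one: the potential and the logarithm\<close>

text \<open>By scaling, \<open>g a c\<close> is \<open>a * g 1 (c / a)\<close>, and
  \<open>c / a\<close> stays in a compact interval of positive reals, where \<open>g 1\<close> is
  bounded.\<close>

lemma potential_bounded:
  assumes "p > 0"
  obtains M where "\<And>a. p \<le> a \<Longrightarrow> a \<le> q \<Longrightarrow> \<bar>potential a\<bar> \<le> M"
proof (cases "p \<le> q")
  case True
  with assms have "q > 0" by simp
  obtain M where M: "\<And>z. 1 / q \<le> z \<Longrightarrow> z \<le> 2 / p \<Longrightarrow> \<bar>g 1 z\<bar> \<le> M"
    by (rule bounded_right[of "1 / q" "2 / p"]) (use \<open>q > 0\<close> in auto)
  obtain M' where M': "\<And>z. 1 \<le> z \<Longrightarrow> z \<le> q + 1 \<Longrightarrow> \<bar>g 1 z\<bar> \<le> M'"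
    by (rule bounded_right[OF zero_less_one, of "q + 1"]) auto
  have "\<bar>potential a\<bar> \<le> q * M + M' * q" if a: "p \<le> a" "a \<le> q" for a
  proof -
    have "norm (integral {1..2} (g a)) \<le> integral {1..2::real} (\<lambda>_. q * M)"
    proof (rule integral_norm_bound_integral)
      show "g a integrable_on {1..2}"
        using a assms by (intro integrable_section) auto
      fix c :: real assume c: "c \<in> {1..2}"
      have "1 / q \<le> c / a" "c / a \<le> 2 / p"
        using c a assms by (auto intro!: frac_le)
      hence "\<bar>g 1 (c / a)\<bar> \<le> M"
        using M a assms by auto
      moreover have "M \<ge> 0"
        using calculation by linarith
      ultimately show "norm (g a c) \<le> q * M"
        using eq_scaled[of a c] c a assms by (auto simp: abs_mult intro!: mult_mono)
    qed auto
    moreover have "norm (integral {1..a + 1} (g 1)) \<le> integral {1..a + 1} (\<lambda>_. M')"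
      using M' a by (intro integral_norm_bound_integral integrable_right) auto
    moreover have "M' * a \<le> M' * q"
      using M'[of 1] a assms by (intro mult_left_mono) auto
    ultimately show ?thesis
      using a assms unfolding potential_def by (simp add: mult.commute)
  qed
  with that show ?thesis .
next
  case False
  with that[of 0] show ?thesis by force
qed

lemma potential_mult:
  assumes "t > 0" "a > 0"
  shows "potential (t * a) = t * potential a + (potential t - t * potential 1) * a"
proof -
  define k where "k a = potential (t * a) - t * potential a" for a
  have add: "k (a + b) = k a + k b" if "a > 0" "b > 0" for a b
  proof -
    have 1: "potential (a + b) = potential a + potential b - g a b"
      using coboundary that by simp
    have 2: "potential (t * (a + b)) = potential (t * a) + potential (t * b) - t * g a b"
      using coboundary[of "t * a" "t * b"] homogeneous_1 that \<open>t > 0\<close> by (simp add: distrib_left)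
    show ?thesis
      unfolding k_def 1 2 by (simp add: algebra_simps)
  qed
  obtain M where M: "\<And>a. 1 \<le> a \<Longrightarrow> a \<le> 2 \<Longrightarrow> \<bar>potential a\<bar> \<le> M"
    by (rule potential_bounded[OF zero_less_one, of 2]) auto
  obtain M' where M': "\<And>a. t \<le> a \<Longrightarrow> a \<le> t * 2 \<Longrightarrow> \<bar>potential a\<bar> \<le> M'"
    by (rule potential_bounded[OF \<open>t > 0\<close>, of "t * 2"]) auto
  \<comment> \<open>The bounds on \<open>potential\<close> hold only away from 0, so
    \<open>k\<close> is bounded at \<open>a + 1\<close> and carried back to \<open>a\<close> by
    additivity.\<close>
  have "\<bar>k a\<bar> \<le> M' + t * M + \<bar>k 1\<bar>" if "0 < a" "a < 1" for a
  proof -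
    have "\<bar>potential (t * (a + 1))\<bar> \<le> M'"
      using that \<open>t > 0\<close> by (intro M') (auto intro: mult_left_mono)
    moreover have "\<bar>t * potential (a + 1)\<bar> \<le> t * M"
      using that \<open>t > 0\<close> M[of "a + 1"] by (simp add: abs_mult)
    ultimately show ?thesis
      using add[of a 1] that unfolding k_def[of "a + 1"] by linarith
  qed
  from additive_bounded_imp_linear[OF add this \<open>a > 0\<close>] show ?thesis
    by (simp add: k_def)
qed

text \<open>The substitution \<open>t = exp x\<close> turns the product-to-sum rule into additivity
  on the reals; boundedness on \<open>{0<..<1}\<close> then makes \<open>l\<close> linear.\<close>

lemma potential_eq:
  "\<exists>C. \<forall>t>0. potential t = C * t * ln t + potential 1 * t"
proof -
  define l where "l x = potential (exp x) / exp x - potential 1" for x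
  have add: "l (x + y) = l x + l y" for x y
    using potential_mult[of "exp x" "exp y"]
    by (simp add: l_def exp_add field_simps)
  obtain M where M: "\<And>a. 1 \<le> a \<Longrightarrow> a \<le> exp 1 \<Longrightarrow> \<bar>potential a\<bar> \<le> M"
    by (rule potential_bounded[OF zero_less_one, of "exp 1"]) auto
  have "\<bar>l x\<bar> \<le> M + \<bar>potential 1\<bar>" if "0 < x" "x < 1" for x
  proof -
    have "\<bar>potential (exp x) / exp x\<bar> \<le> \<bar>potential (exp x)\<bar>"
      using that by (simp add: divide_le_eq mult_left_le mult_le_cancel_left1)
    also have "\<dots> \<le> M"
      using that by (intro M) auto
    finally show ?thesis
      unfolding l_def by linarith
  qed
  hence pos: "l x = l 1 * x" if "x > 0" for x
    using that by (intro additive_bounded_imp_linear[of l]) (auto simp: add)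
  have l_eq: "l x = l 1 * x" for x
  proof (cases x "0::real" rule: linorder_cases)
    case less
    thus ?thesis using pos[of "-x"] add[of 0 0] add[of x "-x"] by simp
  next
    case equal
    thus ?thesis using add[of 0 0] by simp
  qed (rule pos)
  have "potential t = l 1 * t * ln t + potential 1 * t" if "t > 0" for t
    using that l_eq[of "ln t"] by (simp add: l_def[of "ln t"] field_simps)
  thus ?thesis by blast
qed

text \<open>The linear part of the potential drops out of the coboundary because
  \<open>x + (1 - x) = 1\<close>.\<close>

lemma entropy_form:
  "\<exists>C. \<forall>x. 0 < x \<longrightarrow> x < 1 \<longrightarrow> g x (1 - x) = C * (x * ln x + (1 - x) * ln (1 - x))"
proof -
  obtain C where C: "\<forall>t>0. potential t = C * t * ln t + potential 1 * t"
    using potential_eq by blast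
  have "g x (1 - x) = C * (x * ln x + (1 - x) * ln (1 - x))" if "0 < x" "x < 1" for x
  proof -
    have "g x (1 - x) = potential x + potential (1 - x) - potential 1"
      using coboundary[of x "1 - x"] that by simp
    also have "potential x = C * x * ln x + potential 1 * x"
      using C that by blast
    also have "potential (1 - x) = C * (1 - x) * ln (1 - x) + potential 1 * (1 - x)"
      using C that by (metis diff_gt_0_iff_gt)
    finally show ?thesis
      by (simp add: algebra_simps)
  qed
  thus ?thesis by blast
qed

end

section \<open>From the functional equation to cocycles and back\<close>

theorem theorem1p1:
  fixes \<alpha> :: real and u :: "real \<Rightarrow> real"
  assumes "\<alpha> > 0"
    and "u \<in> borel_measurable (lebesgue_on {0..1})"
    and "\<And>x y. x \<in> {0..<1} \<Longrightarrow> y \<in> {0..<1} \<Longrightarrow> x + y \<in> {0..1} \<Longrightarrow>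
           u (1 - x) + (1 - x) powr \<alpha> * u (y / (1 - x)) =
           u y + (1 - y) powr \<alpha> * u ((1 - x - y) / (1 - y))"
  shows "\<exists>c::real. \<forall>x\<in>{0..1}. u x = c * s_entropy \<alpha> x"
proof -
  note eq = assms(3)
  \<comment> \<open>The cocycle sees \<open>u\<close> only inside the open interval, so the
    endpoints are settled first. At \<open>(1/2, 0)\<close> and \<open>(0, 1/2)\<close> the terms
    \<open>u (1/2)\<close> cancel, leaving \<open>u 0\<close> and \<open>u 1\<close> each equal to
    \<open>(1/2) powr \<alpha>\<close> times itself.\<close>
  have u0: "u 0 = 0"
  proof -
    have "2 powr \<alpha> \<noteq> 1"
      using \<open>\<alpha> > 0\<close> by simp
    thus ?thesis
      using eq[of "1/2" 0] by (simp add: powr_divide field_simps)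
  qed
  have u1: "u 1 = 0"
    using eq[of 0 "1/2"] \<open>\<alpha> > 0\<close> by simp
  define g where "g a b = (a + b) powr \<alpha> * u (a / (a + b))" for a b
  have g_diag: "g x (1 - x) = u x" for x
    by (simp add: g_def)
  have u_meas: "u \<in> borel_measurable (lebesgue_on {0<..<1})"
    by (rule measurable_restrict_mono[OF assms(2)]) auto
  have measurable_left: "(\<lambda>z. g z 1) \<in> borel_measurable (lebesgue_on {0<..})"
  proof -
    have "(\<lambda>z. u (z / (z + 1))) \<in> borel_measurable (lebesgue_on {0<..})"
    \<comment> \<open>The map \<open>x / (1 - x)\<close> is the differentiable inverse of
      \<open>z / (z + 1)\<close>.\<close>
    proof (rule borel_measurable_lebesgue_on_compose_inverse[OF u_meas, of "\<lambda>x. x / (1 - x)"])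
      show "(\<lambda>x::real. x / (1 - x)) differentiable_on {0<..<1}"
        unfolding differentiable_on_def by (auto intro!: differentiable_divide)
      show "(\<lambda>x::real. x / (1 - x)) ` {0<..<1} = {0<..}"
      proof (intro equalityI subsetI)
        fix z :: real assume "z \<in> {0<..}"
        thus "z \<in> (\<lambda>x. x / (1 - x)) ` {0<..<1}"
          by (intro image_eqI[of _ _ "z / (z + 1)"]) (auto simp: field_simps)
      qed auto
    qed (auto simp: field_simps)
    moreover have "(\<lambda>z. (z + 1) powr \<alpha>) \<in> borel_measurable (lebesgue_on {0<..})"
      by (intro continuous_imp_measurable_on_sets_lebesgue continuous_intros) auto
    ultimately show ?thesis
      unfolding g_def by (intro borel_measurable_times)
  qed
  have measurable_right: "g 1 \<in> borel_measurable (lebesgue_on {0<..})"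
  proof -
    have "(\<lambda>z. u (1 / (1 + z))) \<in> borel_measurable (lebesgue_on {0<..})"
    proof (rule borel_measurable_lebesgue_on_compose_inverse[OF u_meas, of "\<lambda>x. (1 - x) / x"])
      show "(\<lambda>x::real. (1 - x) / x) differentiable_on {0<..<1}"
        unfolding differentiable_on_def by (auto intro!: differentiable_divide)
      show "(\<lambda>x::real. (1 - x) / x) ` {0<..<1} = {0<..}"
      proof (intro equalityI subsetI)
        fix z :: real assume "z \<in> {0<..}"
        thus "z \<in> (\<lambda>x. (1 - x) / x) ` {0<..<1}"
          by (intro image_eqI[of _ _ "1 / (1 + z)"]) (auto simp: field_simps)
      qed auto
    qed (auto simp: field_simps)
    moreover have "(\<lambda>z. (1 + z) powr \<alpha>) \<in> borel_measurable (lebesgue_on {0<..})"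
      by (intro continuous_imp_measurable_on_sets_lebesgue continuous_intros) auto
    ultimately show ?thesis
      unfolding g_def by (intro borel_measurable_times)
  qed
  interpret homogeneous_cocycle g \<alpha>
  proof
    fix a b c :: real assume abc: "a > 0" "b > 0" "c > 0"
    \<comment> \<open>Normalizing the sum to 1, the cocycle equation is the functional equation at
      \<open>x = c / s\<close>, \<open>y = a / s\<close>, multiplied by
      \<open>s powr \<alpha>\<close>.\<close>
    define s where "s = a + b + c"
    have s: "s > 0" "a + (b + c) = s" "a + b + c = s"
      using abc by (simp_all add: s_def)
    have e: "1 - c / s = (a + b) / s" "1 - a / s = (b + c) / s" "(a + b) / s - a / s = b / s"
      using s(1) by (auto simp: s_def divide_simps)
    have "c / s \<in> {0..<1}" "a / s \<in> {0..<1}" "c / s + a / s \<in> {0..1}"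
      using abc s(1) by (auto simp: s_def divide_simps)
    from eq[OF this]
    have "u ((a + b) / s) + ((a + b) / s) powr \<alpha> * u (a / s / ((a + b) / s)) =
        u (a / s) + ((b + c) / s) powr \<alpha> * u (b / s / ((b + c) / s))"
      unfolding e .
    hence eq': "u ((a + b) / s) + (a + b) powr \<alpha> / s powr \<alpha> * u (a / (a + b)) =
        u (a / s) + (b + c) powr \<alpha> / s powr \<alpha> * u (b / (b + c))"
      using abc s(1) by (simp add: powr_divide)
    have clear_denominator: "P * X + A * U = P * Y + B * V"
      if "X + A / P * U = Y + B / P * V" "P \<noteq> 0" for P X A U Y B V :: real
      using that by (simp add: field_simps)
    have "s powr \<alpha> * u ((a + b) / s) + (a + b) powr \<alpha> * u (a / (a + b)) =
        s powr \<alpha> * u (a / s) + (b + c) powr \<alpha> * u (b / (b + c))"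
      by (rule clear_denominator[OF eq']) (use s(1) in simp)
    thus "g (a + b) c + g a b = g a (b + c) + g b c"
      unfolding g_def s(2,3) .
  next
    fix t a b :: real assume t: "t > 0" "a > 0" "b > 0"
    have "t * a + t * b = t * (a + b)"
      by (simp add: distrib_left)
    with t show "g (t * a) (t * b) = t powr \<alpha> * g a b"
      by (simp add: g_def powr_mult)
  qed (rule measurable_left measurable_right)+
  have "\<exists>C. \<forall>x. 0 < x \<longrightarrow> x < 1 \<longrightarrow> u x = C * s_entropy \<alpha> x"
  proof (cases "\<alpha> = 1")
    case True
    then interpret homogeneous_cocycle_1 g
      using homogeneous_cocycle_axioms by (simp add: homogeneous_cocycle_1_def)
    obtain C where C: "\<forall>x. 0 < x \<longrightarrow> x < 1 \<longrightarrow> g x (1 - x) = C * (x * ln x + (1 - x) * ln (1 - x))"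
      using entropy_form by blast
    have "x * ln x + (1 - x) * ln (1 - x) = - ln 2 * s_entropy \<alpha> x" for x
      unfolding s_entropy_def log_def using True by (simp add: field_simps)
    hence "u x = (C * - ln 2) * s_entropy \<alpha> x" if "0 < x" "x < 1" for x
      using C that unfolding g_diag by (simp only: mult.assoc)
    thus ?thesis by blast
  next
    case False
    \<comment> \<open>This is the factor \<open>y powr \<alpha> + (1 - y) powr \<alpha> - 1\<close>
      of \<open>product_rule\<close> at \<open>y = 1/2\<close>. It is nonzero since
      \<open>\<alpha>\<close> differs from 1, so the rule can be solved for
      \<open>u x\<close>.\<close>
    define k where "k = 2 * (1/2) powr \<alpha> - (1::real)"
    have "k = 2 powr (1 - \<alpha>) - 1"
      by (simp add: k_def powr_diff powr_divide)
    hence "k \<noteq> 0"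
      using False by simp
    have "u x = ((1 - \<alpha>) * u (1/2) / k) * s_entropy \<alpha> x" if "0 < x" "x < 1" for x
    proof -
      have "(x powr \<alpha> + (1 - x) powr \<alpha> - 1) * u (1/2) = k * u x"
        using product_rule[OF that, of "1/2"] g_diag[of x] g_diag[of "1/2"] by (simp add: k_def)
      thus ?thesis
        using False \<open>k \<noteq> 0\<close> by (simp add: s_entropy_def field_simps)
    qed
    thus ?thesis by blast
  qed
  then obtain C where C: "\<forall>x. 0 < x \<longrightarrow> x < 1 \<longrightarrow> u x = C * s_entropy \<alpha> x" ..
  have "s_entropy \<alpha> 0 = 0" "s_entropy \<alpha> 1 = 0"
    using \<open>\<alpha> > 0\<close> by (simp_all add: s_entropy_def)
  with C u0 u1 have "u x = C * s_entropy \<alpha> x" if "x \<in> {0..1}" for x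
    using that by (cases "x = 0 \<or> x = 1") auto
  thus ?thesis by blast
qed

end
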